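(* Consider a chemical reaction with $M$ species and $R$ reaction steps, given by matrices $\boldsymbol{\alpha},\boldsymbol{\beta}\in\mathbb{Z}_{\ge 0}^{M\times R}$, and let $\boldsymbol{\gamma}=\boldsymbol{\beta}-\boldsymbol{\alpha}$. Suppose all reaction rate coefficients are control inputs, i.e. consider the driftless control system $$\dot{\boldsymbol{x}}(t)=\sum_{r=1}^R \boldsymbol{\gamma}(\cdot,r)\,\boldsymbol{x}(t)^{\boldsymbol{\alpha}(\cdot,r)}\,u_r(t).$$ Then the reaction is controllable at almost every point $\boldsymbol{x}\in\mathbb{R}^M$ (with respect to Lebesgue measure). Moreover, it is controllable at every point of the positive orthant $\{\boldsymbol{x}\in\mathbb{R}^M : x_m>0,\ m=1,\dots,M\}$.
   Context: The $r$th reaction step is $\sum_{m}\alpha(m,r)X_m\to\sum_m\beta(m,r)X_m$, where $X_1,\dots,X_M$ are the species. The matrix $\boldsymbol{\gamma}=\boldsymbol{\beta}-\boldsymbol{\alpha}$ is the stoichiometric matrix, and $\boldsymbol{\gamma}(\cdot,r)$ and $\boldsymbol{\alpha}(\cdot,r)$ denote $r$th columns. For $\boldsymbol{x}\in\mathbb{R}^M$, $\boldsymbol{x}^{\boldsymbol{\alpha}(\cdot,r)}=\prod_{m=1}^M x_m^{\alpha(m,r)}$ (with $0^0=1$). Put $\boldsymbol{g}_r(\boldsymbol{x})=\boldsymbol{\gamma}(\cdot,r)\boldsymbol{x}^{\boldsymbol{\alpha}(\cdot,r)}$. The Lie bracket of smooth vector fields on $\mathbb{R}^M$ is $[\boldsymbol{\varphi},\boldsymbol{\psi}]=\boldsymbol{\psi}'\boldsymbol{\varphi}-\boldsymbol{\varphi}'\boldsymbol{\psi}$,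 where $'$ denotes the Jacobian. For an input affine system $\dot{\boldsymbol{x}}=\boldsymbol{f}(\boldsymbol{x})+\sum_{j=1}^J\boldsymbol{g}_j(\boldsymbol{x})u_j$, let $\mathcal{L}$ be the smallest linear subspace of $\mathcal{C}^\infty(\mathbb{R}^M,\mathbb{R}^M)$ that contains all $\boldsymbol{g}_j$, contains $[\boldsymbol{\tau},\boldsymbol{f}]$ whenever it contains $\boldsymbol{\tau}$, and contains $[\boldsymbol{\tau}_1,\boldsymbol{\tau}_2]$ whenever it contains $\boldsymbol{\tau}_1,\boldsymbol{\tau}_2$. The controllability distribution is $\Delta_C(\boldsymbol{x})=\{\boldsymbol{\tau}(\boldsymbol{x}):\boldsymbol{\tau}\in\mathcal{L}\}\subseteq\mathbb{R}^M$. Here $\boldsymbol{f}=0$ and $J=R$. A chemical reaction is called controllable at a point $\boldsymbol{x}^*\in\mathbb{R}^M$ if $\dim\Delta_C(\boldsymbol{x}^* )=\operatorname{rank}\boldsymbol{\gamma}$. *)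

theory Defs
  imports "HOL-Analysis.Analysis"
begin

type_synonym 'm vector_field = "real ^ 'm \<Rightarrow> real ^ 'm"

fun C_k :: "nat \<Rightarrow> 'm::finite vector_field \<Rightarrow> bool" where
  "C_k 0 f \<longleftrightarrow> continuous_on UNIV f"
| "C_k (Suc k) f \<longleftrightarrow> f differentiable_on UNIV \<and>
     (\<forall>i. C_k k (\<lambda>x. frechet_derivative f (at x) (axis i 1)))"

definition smooth_vector_fields :: "'m::finite vector_field set" where
  "smooth_vector_fields = {f. \<forall>k. C_k k f}"

definition lie_bracket ::
    "'m::finite vector_field \<Rightarrow> 'm vector_field \<Rightarrow> 'm vector_field" where
  "lie_bracket \<phi> \<psi> =
     (\<lambda>x. jacobian \<psi> (at x) *v \<phi> x - jacobian \<phi> (at x) *v \<psi> x)"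

(* Function spaces are not an instance of real_vector, so the library predicate
   subspace does not apply to sets of vector fields. *)
definition vf_subspace :: "'m::finite vector_field set \<Rightarrow> bool" where
  "vf_subspace V \<longleftrightarrow>
     (\<lambda>x. 0) \<in> V \<and>
     (\<forall>\<sigma>\<in>V. \<forall>\<tau>\<in>V. (\<lambda>x. \<sigma> x + \<tau> x) \<in> V) \<and>
     (\<forall>c. \<forall>\<tau>\<in>V. (\<lambda>x. c *\<^sub>R \<tau> x) \<in> V)"

(* The system is x' = f x + (SUM j. u j *R g j x), with smooth f and g j. The
   intersection below ranges over a nonempty family, because the space of all
   smooth vector fields is closed under the Lie bracket. *)
definition control_algebra ::
    "'m::finite vector_field \<Rightarrow> ('j \<Rightarrow> 'm vector_field) \<Rightarrow> 'm vector_field set" where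
  "control_algebra f g =
     \<Inter>{V. V \<subseteq> smooth_vector_fields \<and> vf_subspace V \<and> (\<forall>j. g j \<in> V) \<and>
         (\<forall>\<tau>\<in>V. lie_bracket \<tau> f \<in> V) \<and>
         (\<forall>\<tau>\<^sub>1\<in>V. \<forall>\<tau>\<^sub>2\<in>V. lie_bracket \<tau>\<^sub>1 \<tau>\<^sub>2 \<in> V)}"

definition controllability_distribution ::
    "'m::finite vector_field \<Rightarrow> ('j \<Rightarrow> 'm vector_field) \<Rightarrow> real ^ 'm \<Rightarrow> (real ^ 'm) set" where
  "controllability_distribution f g x = {\<tau> x | \<tau>. \<tau> \<in> control_algebra f g}"

(* Complexes are stored as matrices with \<alpha> $ m $ r the coefficient of species m
   in reaction step r. *)
definition stoich_matrix ::
    "nat ^ 'r ^ 'm \<Rightarrow> nat ^ 'r ^ 'm \<Rightarrow> real ^ 'r ^ 'm" where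
  "stoich_matrix \<alpha> \<beta> = (\<chi> m r. real (\<beta> $ m $ r) - real (\<alpha> $ m $ r))"

definition reaction_monomial ::
    "nat ^ 'r ^ 'm \<Rightarrow> 'r \<Rightarrow> real ^ 'm::finite \<Rightarrow> real" where
  "reaction_monomial \<alpha> r x = (\<Prod>m\<in>UNIV. (x $ m) ^ (\<alpha> $ m $ r))"

definition reaction_field ::
    "nat ^ 'r ^ 'm \<Rightarrow> nat ^ 'r ^ 'm \<Rightarrow> 'r \<Rightarrow> 'm::finite vector_field" where
  "reaction_field \<alpha> \<beta> r =
     (\<lambda>x. reaction_monomial \<alpha> r x *\<^sub>R column r (stoich_matrix \<alpha> \<beta>))"

(* All rate coefficients are control inputs, so the drift vanishes and there is
   one input per reaction step. *)
definition controllable_at ::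
    "nat ^ 'r::finite ^ 'm::finite \<Rightarrow> nat ^ 'r ^ 'm \<Rightarrow> real ^ 'm \<Rightarrow> bool" where
  "controllable_at \<alpha> \<beta> x \<longleftrightarrow>
     dim (controllability_distribution (\<lambda>_. 0) (reaction_field \<alpha> \<beta>) x)
       = rank (stoich_matrix \<alpha> \<beta>)"

end

theory Submission
  imports Defs
begin

text \<open>
  Write \<open>S\<close> for the column space of the stoichiometric matrix, so that \<open>dim S\<close> is its rank.
  Every input field \<open>g\<^sub>r\<close> is a scalar monomial times the \<open>r\<close>th column, hence takes values in \<open>S\<close>
  everywhere.

  Upper bound. Differentiation does not leave a linear subspace: if \<open>\<psi>\<close> takes values in \<open>S\<close>, so
  does each directional derivative of \<open>\<psi>\<close> (\<open>has_derivative_in_subspace\<close>), and therefore so does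
  \<open>[\<phi>, \<psi>]\<close>. Thus Lie brackets produce no directions outside \<open>S\<close>. The vector fields with polynomial
  components and values in \<open>S\<close> consequently form an admissible space in the definition of the
  control algebra; polynomials are chosen over general smooth fields because their smoothness and
  their closure under differentiation follow by induction on the polynomial. This gives
  \<open>\<Delta>\<^sub>C(x) \<subseteq> S\<close> at every \<open>x\<close>.

  Lower bound. The input fields themselves suffice: \<open>\<Delta>\<^sub>C(x)\<close> contains all \<open>g\<^sub>r(x)\<close>, and if no coordinate of \<open>x\<close>
  vanishes then each monomial is nonzero at \<open>x\<close>, so the \<open>g\<^sub>r(x)\<close> are nonzero multiples of the
  columns and span \<open>S\<close>. The points left out lie in finitely many coordinate hyperplanes, which
  have measure zero and miss the positive orthant.
\<close>

section \<open>Derivatives of polynomial maps\<close>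

lemma real_polynomial_function_has_derivative:
  fixes p :: "'a::real_normed_vector \<Rightarrow> real"
  assumes "real_polynomial_function p"
  shows "\<exists>p'. (\<forall>x. (p has_derivative p' x) (at x)) \<and>
    (\<forall>h. real_polynomial_function (\<lambda>x. p' x h))"
  using assms
proof (induction p rule: real_polynomial_function.induct)
  case (linear f)
  then show ?case
    by (intro exI[of _ "\<lambda>x. f"]) (auto intro: bounded_linear_imp_has_derivative)
next
  case (const c)
  show ?case
    by (intro exI[of _ "\<lambda>x h. 0"]) auto
next
  case (add f g)
  then obtain f' g' where
    "\<And>x. (f has_derivative f' x) (at x)" "\<And>h. real_polynomial_function (\<lambda>x. f' x h)"
    "\<And>x. (g has_derivative g' x) (at x)" "\<And>h. real_polynomial_function (\<lambda>x. g' x h)"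
    by auto
  then show ?case
    by (intro exI[of _ "\<lambda>x h. f' x h + g' x h"]) (auto intro: has_derivative_add)
next
  case (mult f g)
  then obtain f' g' where
    "\<And>x. (f has_derivative f' x) (at x)" "\<And>h. real_polynomial_function (\<lambda>x. f' x h)"
    "\<And>x. (g has_derivative g' x) (at x)" "\<And>h. real_polynomial_function (\<lambda>x. g' x h)"
    by auto
  with mult.hyps show ?case
    by (intro exI[of _ "\<lambda>x h. f x * g' x h + f' x h * g x"])
      (auto intro!: has_derivative_mult real_polynomial_function.intros(3,4))
qed

lemma polynomial_function_has_frechet_derivative:
  fixes p :: "'a::euclidean_space \<Rightarrow> 'b::euclidean_space"
  assumes "polynomial_function p"
  shows "(p has_derivative frechet_derivative p (at x)) (at x)"
  using assms differentiable_at_polynomial_function frechet_derivative_works by blast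

text \<open>The components of the derivative are the derivatives of the components, so the claim reduces
  to scalar polynomials.\<close>

lemma polynomial_function_frechet_derivative:
  fixes p :: "'a::euclidean_space \<Rightarrow> 'b::euclidean_space"
  assumes "polynomial_function p"
  shows "polynomial_function (\<lambda>x. frechet_derivative p (at x) h)"
  unfolding polynomial_function_iff_Basis_inner
proof
  fix b :: 'b
  assume "b \<in> Basis"
  then have "real_polynomial_function (\<lambda>x. p x \<bullet> b)"
    using assms by (simp add: polynomial_function_iff_Basis_inner)
  then obtain q where q: "\<And>x. ((\<lambda>x. p x \<bullet> b) has_derivative q x) (at x)"
      "real_polynomial_function (\<lambda>x. q x h)"
    using real_polynomial_function_has_derivative by blast
  have "frechet_derivative p (at x) h \<bullet> b = q x h" for x
    using has_derivative_unique[OF q(1) has_derivative_inner_left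
        [OF polynomial_function_has_frechet_derivative[OF assms]]]
    by metis
  with q(2) show "real_polynomial_function (\<lambda>x. frechet_derivative p (at x) h \<bullet> b)"
    by simp
qed

lemma polynomial_function_smooth:
  fixes p :: "'m::finite vector_field"
  assumes "polynomial_function p"
  shows "p \<in> smooth_vector_fields"
proof -
  have "C_k k p" if "polynomial_function p" for k and p :: "'m vector_field"
    using that
  proof (induction k arbitrary: p)
    case 0
    then show ?case
      by (simp add: continuous_on_polymonial_function)
  next
    case (Suc k)
    then show ?case
      by (simp add: differentiable_on_polynomial_function polynomial_function_frechet_derivative)
  qed
  with assms show ?thesis
    by (simp add: smooth_vector_fields_def)
qed

text \<open>A vector lies in \<open>S\<close> iff it is orthogonal to every vector orthogonal to \<open>S\<close>. For such a
  normal vector \<open>z\<close> the function \<open>\<lambda>x. z \<bullet> f x\<close> vanishes identically, hence so does its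
  derivative.\<close>

lemma has_derivative_in_subspace:
  fixes f :: "'a::real_normed_vector \<Rightarrow> 'b::euclidean_space"
  assumes "(f has_derivative f') (at x)" "subspace S" "\<And>y. f y \<in> S"
  shows "f' h \<in> S"
proof -
  have "z \<bullet> f' h = 0" if "z \<in> S\<^sup>\<bottom>" for z
  proof -
    have zero: "(\<lambda>y. z \<bullet> f y) = (\<lambda>y. 0)"
      using that assms(3) by (force simp: orthogonal_comp_def orthogonal_def inner_commute)
    have "((\<lambda>y. z \<bullet> f y) has_derivative (\<lambda>h. z \<bullet> f' h)) (at x)"
      using assms(1) by (rule has_derivative_inner_right)
    then show ?thesis
      unfolding zero using has_derivative_unique has_derivative_const by metis
  qed
  then have "f' h \<in> S\<^sup>\<bottom>\<^sup>\<bottom>"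
    by (auto simp: orthogonal_comp_def orthogonal_def)
  then show ?thesis
    by (simp add: orthogonal_comp_self assms(2))
qed

section \<open>Polynomial vector fields with values in a subspace\<close>

definition polynomial_fields_into :: "(real ^ 'm) set \<Rightarrow> 'm::finite vector_field set" where
  "polynomial_fields_into S = {\<tau>. polynomial_function \<tau> \<and> range \<tau> \<subseteq> S}"

lemma jacobian_mult_eq_frechet_derivative:
  fixes p :: "'m::finite vector_field"
  assumes "polynomial_function p"
  shows "jacobian p (at x) *v v = frechet_derivative p (at x) v"
  unfolding jacobian_def
  using has_derivative_linear[OF polynomial_function_has_frechet_derivative[OF assms]]
  by (simp add: matrix_works)

lemma polynomial_fields_into_derivative_along:
  fixes \<phi> \<psi> :: "'m::finite vector_field"
  assumes "subspace S" "\<phi> \<in> polynomial_fields_into S" "\<psi> \<in> polynomial_fields_into S"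
  shows "(\<lambda>x. jacobian \<psi> (at x) *v \<phi> x) \<in> polynomial_fields_into S"
proof -
  have poly: "polynomial_function \<phi>" "polynomial_function \<psi>" and into: "\<And>x. \<psi> x \<in> S"
    using assms by (auto simp: polynomial_fields_into_def)
  have "jacobian \<psi> (at x) *v \<phi> x \<in> S" for x
    using has_derivative_in_subspace[OF polynomial_function_has_frechet_derivative[OF poly(2)]
        assms(1) into]
    by (simp add: jacobian_mult_eq_frechet_derivative[OF poly(2)])
  moreover have "polynomial_function (\<lambda>x. jacobian \<psi> (at x) *v \<phi> x)"
  proof -
    \<comment> \<open>The direction \<open>\<phi> x\<close> varies with \<open>x\<close>; expanding it in the standard basis leaves
        derivatives in fixed directions.\<close>
    have "jacobian \<psi> (at x) *v \<phi> x =
        (\<Sum>b\<in>Basis. (\<phi> x \<bullet> b) *\<^sub>R frechet_derivative \<psi> (at x) b)" for x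
    proof -
      have lin: "linear (frechet_derivative \<psi> (at x))"
        using polynomial_function_has_frechet_derivative[OF poly(2)] by (rule has_derivative_linear)
      have "frechet_derivative \<psi> (at x) (\<phi> x) =
          frechet_derivative \<psi> (at x) (\<Sum>b\<in>Basis. (\<phi> x \<bullet> b) *\<^sub>R b)"
        by (simp add: euclidean_representation)
      also have "\<dots> = (\<Sum>b\<in>Basis. (\<phi> x \<bullet> b) *\<^sub>R frechet_derivative \<psi> (at x) b)"
        by (simp add: linear_sum[OF lin] linear_scale[OF lin])
      finally show ?thesis
        by (simp add: jacobian_mult_eq_frechet_derivative[OF poly(2)])
    qed
    moreover have "polynomial_function (\<lambda>x. \<phi> x \<bullet> b)" if "b \<in> Basis" for b
      using poly(1) that
      by (simp add: polynomial_function_iff_Basis_inner flip: real_polynomial_function_eq)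
    ultimately show ?thesis
      by (auto intro!: polynomial_function_sum polynomial_function_mult
          polynomial_function_frechet_derivative poly(2))
  qed
  ultimately show ?thesis
    by (auto simp: polynomial_fields_into_def)
qed

lemma polynomial_fields_into_lie_bracket:
  fixes \<phi> \<psi> :: "'m::finite vector_field"
  assumes S: "subspace S" and "\<phi> \<in> polynomial_fields_into S" "\<psi> \<in> polynomial_fields_into S"
  shows "lie_bracket \<phi> \<psi> \<in> polynomial_fields_into S"
  using polynomial_fields_into_derivative_along[OF assms]
    polynomial_fields_into_derivative_along[OF S assms(3,2)]
  by (auto simp: polynomial_fields_into_def lie_bracket_def intro!: subspace_diff[OF S])

lemma vf_subspace_polynomial_fields_into:
  assumes "subspace S"
  shows "vf_subspace (polynomial_fields_into S)"
  using assms
  by (auto simp: vf_subspace_def polynomial_fields_into_def image_subset_iff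
      subspace_0 subspace_add subspace_scale)

section \<open>The controllability distribution of a driftless system\<close>

lemma input_field_in_controllability_distribution:
  "g j x \<in> controllability_distribution f g x"
  by (auto simp: controllability_distribution_def control_algebra_def)

lemma controllability_distribution_subset:
  fixes g :: "'j \<Rightarrow> 'm::finite vector_field"
  assumes S: "subspace S" and g: "\<And>j. g j \<in> polynomial_fields_into S"
  shows "controllability_distribution (\<lambda>_. 0) g x \<subseteq> S"
proof -
  have zero: "(\<lambda>_. 0) \<in> polynomial_fields_into S"
    using vf_subspace_polynomial_fields_into[OF S] by (simp add: vf_subspace_def)
  have "polynomial_fields_into S \<subseteq> smooth_vector_fields"
    by (auto simp: polynomial_fields_into_def intro: polynomial_function_smooth)
  then have "control_algebra (\<lambda>_. 0) g \<subseteq> polynomial_fields_into S"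
    unfolding control_algebra_def
    using S g zero vf_subspace_polynomial_fields_into polynomial_fields_into_lie_bracket
    by (intro Inter_lower) auto
  then show ?thesis
    by (auto simp: controllability_distribution_def polynomial_fields_into_def)
qed

section \<open>Chemical reactions\<close>

lemma reaction_field_polynomial:
  fixes \<alpha> \<beta> :: "nat ^ 'r::finite ^ 'm::finite"
  shows "reaction_field \<alpha> \<beta> r \<in>
    polynomial_fields_into (span (columns (stoich_matrix \<alpha> \<beta>)))"
proof -
  have "polynomial_function (\<lambda>x::real ^ 'm. x $ m)" for m
    by (intro polynomial_function_bounded_linear bounded_linear_vec_nth)
  then have "real_polynomial_function (reaction_monomial \<alpha> r)"
    unfolding reaction_monomial_def
    by (intro real_polynomial_function_prod real_polynomial_function_power)
      (simp_all add: real_polynomial_function_eq)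
  then have "polynomial_function (reaction_field \<alpha> \<beta> r)"
    unfolding reaction_field_def
    by (intro polynomial_function_mult) (simp_all add: real_polynomial_function_eq)
  moreover have "range (reaction_field \<alpha> \<beta> r) \<subseteq> span (columns (stoich_matrix \<alpha> \<beta>))"
    unfolding reaction_field_def columns_def by (auto intro: span_scale[OF span_base])
  ultimately show ?thesis
    by (simp add: polynomial_fields_into_def)
qed

lemma controllable_at_nonzero_coordinates:
  fixes \<alpha> \<beta> :: "nat ^ 'r::finite ^ 'm::finite"
  assumes "\<And>m. x $ m \<noteq> 0"
  shows "controllable_at \<alpha> \<beta> x"
proof -
  define C where "C = columns (stoich_matrix \<alpha> \<beta>)"
  define D where "D = controllability_distribution (\<lambda>_. 0) (reaction_field \<alpha> \<beta>) x"
  have "D \<subseteq> span C"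
    unfolding C_def D_def
    by (intro controllability_distribution_subset subspace_span reaction_field_polynomial)
  moreover have "column r (stoich_matrix \<alpha> \<beta>) \<in> span D" for r
  proof -
    have nz: "reaction_monomial \<alpha> r x \<noteq> 0"
      using assms by (simp add: reaction_monomial_def)
    have "reaction_field \<alpha> \<beta> r x \<in> span D"
      unfolding D_def by (intro span_base input_field_in_controllability_distribution)
    then have "inverse (reaction_monomial \<alpha> r x) *\<^sub>R reaction_field \<alpha> \<beta> r x \<in> span D"
      by (rule span_scale)
    then show ?thesis
      using nz by (simp add: reaction_field_def)
  qed
  then have "C \<subseteq> span D"
    by (auto simp: C_def columns_def)
  ultimately have "span D = span C"
    by (simp add: span_eq)
  then have "dim D = dim C"
    by (metis dim_span)
  then show ?thesis
    by (simp add: controllable_at_def column_rank_def C_def D_def)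
qed

lemma AE_nonzero_coordinates:
  "AE x in lebesgue. \<forall>m::'m::finite. (x :: real ^ 'm) $ m \<noteq> 0"
proof -
  have "AE x in lebesgue. (x :: real ^ 'm) $ m \<noteq> 0" for m :: 'm
  proof -
    have "negligible {x :: real ^ 'm. x $ m = 0}"
      by (rule negligible_standard_hyperplane_cart)
    then show ?thesis
      unfolding negligible_iff_null_sets by (rule AE_I') auto
  qed
  then show ?thesis
    by (simp add: AE_all_countable)
qed

theorem theorem4:
  fixes \<alpha> \<beta> :: "nat ^ 'r::finite ^ 'm::finite"
  shows "(AE x in lebesgue. controllable_at \<alpha> \<beta> x) \<and>
    (\<forall>x. (\<forall>m. x $ m > 0) \<longrightarrow> controllable_at \<alpha> \<beta> x)"
proof
  show "AE x in lebesgue. controllable_at \<alpha> \<beta> x"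
    using AE_nonzero_coordinates
    by eventually_elim (simp add: controllable_at_nonzero_coordinates)
  show "\<forall>x. (\<forall>m. x $ m > 0) \<longrightarrow> controllable_at \<alpha> \<beta> x"
    by (metis controllable_at_nonzero_coordinates less_irrefl)
qed

end
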